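(* Let $n\ge 3$ and let $K_n$ be the complete graph on vertices $v_1,\dots,v_n$. Then $$\mathcal{E}_S(v_i)=\frac{2(n-1)}{n},\qquad i=1,\dots,n.$$
   Context: All graphs are finite, simple and undirected. The Seidel matrix of a graph $G$ with vertex set $\{v_1,\dots,v_n\}$ is the real symmetric $n\times n$ matrix $S(G)=[s_{ij}]$ with $s_{ii}=0$, and for $i\neq j$, $s_{ij}=-1$ if $v_i$ and $v_j$ are adjacent and $s_{ij}=1$ otherwise. For a real symmetric matrix $S$, $|S|=(S^2)^{1/2}$ is the positive semidefinite square root of $S^2$. The vertex Seidel energy of $v_i$ is $\mathcal{E}_S(v_i)=|S(G)|_{ii}$, the $i$-th diagonal entry of $|S(G)|$. *)

theory Defs
  imports "Graph_Theory.Kuratowski" "Jordan_Normal_Form.Matrix"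
begin

text \<open>
  Finite simple undirected graphs are the locale \<^locale>\<open>graph\<close> of \<^theory>\<open>Graph_Theory.Digraph\<close>
  (finite digraphs with a symmetric arc relation and without loops or parallel arcs), and
  \<^term>\<open>complete_digraph n G\<close> says that G is a complete graph on n vertices.

  The function v lists the vertices: it is meant to be a bijection from
  \<^term>\<open>{..<card (verts G)}\<close> onto \<^term>\<open>verts G\<close>.  Indices start at 0, as in
  \<^theory>\<open>Jordan_Normal_Form.Matrix\<close>.
\<close>

definition seidel_mat :: "('a, 'b) pre_digraph \<Rightarrow> (nat \<Rightarrow> 'a) \<Rightarrow> real mat" where
  "seidel_mat G v = mat (card (verts G)) (card (verts G))
     (\<lambda>(i, j). if i = j then 0 else if (v i, v j) \<in> arcs_ends G then -1 else 1)"

definition pos_semidef_mat :: "real mat \<Rightarrow> bool" where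
  "pos_semidef_mat A \<longleftrightarrow> square_mat A \<and> A\<^sup>T = A \<and>
     (\<forall>x \<in> carrier_vec (dim_row A). 0 \<le> x \<bullet> (A *\<^sub>v x))"

text \<open>The matrix below is determined uniquely when A is positive semidefinite.\<close>

definition sqrt_mat :: "real mat \<Rightarrow> real mat" where
  "sqrt_mat A = (THE P. pos_semidef_mat P \<and> P * P = A)"

definition abs_mat :: "real mat \<Rightarrow> real mat" where
  "abs_mat S = sqrt_mat (S * S)"

definition vertex_seidel_energy :: "('a, 'b) pre_digraph \<Rightarrow> (nat \<Rightarrow> 'a) \<Rightarrow> nat \<Rightarrow> real" where
  "vertex_seidel_energy G v i = abs_mat (seidel_mat G v) $$ (i, i)"

end

theory Submission
  imports Defs
begin

text \<open>With \<open>J\<close> the all-ones matrix, \<open>S(K\<^sub>n) = I - J\<close> and \<open>S\<^sup>2 = I + (n - 2) J\<close>. The matrix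
  \<open>I + (n - 2)/n J\<close> is positive semidefinite with the same square, so by uniqueness of positive
  semidefinite square roots it is \<open>|S|\<close>, and its diagonal entries are \<open>1 + (n - 2)/n\<close>.\<close>

lemma trace_comm:
  fixes A B :: "'a::comm_semiring_0 mat"
  assumes "A \<in> carrier_mat n m" "B \<in> carrier_mat m n"
  shows "(\<Sum>i<n. (A * B) $$ (i, i)) = (\<Sum>i<m. (B * A) $$ (i, i))"
proof -
  have "(\<Sum>i<n. (A * B) $$ (i, i)) = (\<Sum>i<n. \<Sum>k<m. A $$ (i, k) * B $$ (k, i))"
    using assms by (intro sum.cong refl) (auto simp: scalar_prod_def atLeast0LessThan)
  also have "\<dots> = (\<Sum>k<m. \<Sum>i<n. B $$ (k, i) * A $$ (i, k))"
    by (subst sum.swap) (simp add: mult.commute)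
  also have "\<dots> = (\<Sum>k<m. (B * A) $$ (k, k))"
    using assms by (intro sum.cong refl) (auto simp: scalar_prod_def atLeast0LessThan)
  finally show ?thesis .
qed

lemma scalar_prod_self_nonneg: "0 \<le> x \<bullet> (x :: real vec)"
  by (simp add: scalar_prod_def sum_nonneg)

lemma scalar_prod_self_eq_0:
  assumes "x \<bullet> x = 0" "x \<in> carrier_vec n"
  shows "x = (0\<^sub>v n :: real vec)"
  using assms by (intro eq_vecI) (auto simp: scalar_prod_def sum_nonneg_eq_0_iff)

lemma symmetric_scalar_prod:
  fixes P :: "real mat"
  assumes "P \<in> carrier_mat n n" "P\<^sup>T = P" "x \<in> carrier_vec n" "y \<in> carrier_vec n"
  shows "x \<bullet> (P *\<^sub>v y) = (P *\<^sub>v x) \<bullet> y"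
  using transpose_vec_mult_scalar[of P n n y x] assms by simp

text \<open>Otherwise the quadratic form would be negative at \<open>x - t y\<close> for \<open>y = P x\<close> and a small
  \<open>t > 0\<close>.\<close>

lemma pos_semidef_mat_kernel:
  assumes P: "pos_semidef_mat P" "P \<in> carrier_mat n n"
    and x: "x \<in> carrier_vec n" "x \<bullet> (P *\<^sub>v x) = 0"
  shows "P *\<^sub>v x = 0\<^sub>v n"
proof (rule scalar_prod_self_eq_0)
  let ?y = "P *\<^sub>v x"
  have y: "?y \<in> carrier_vec n" using P x by simp
  have sym: "P\<^sup>T = P" using P by (simp add: pos_semidef_mat_def)
  define a where "a = ?y \<bullet> ?y"
  define c where "c = ?y \<bullet> (P *\<^sub>v ?y)"
  have xPy: "x \<bullet> (P *\<^sub>v ?y) = a"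
    using symmetric_scalar_prod[OF P(2) sym x(1) y] by (simp add: a_def)
  have nonneg: "0 \<le> z \<bullet> (P *\<^sub>v z)" if "z \<in> carrier_vec n" for z
    using P that by (auto simp: pos_semidef_mat_def)
  \<comment> \<open>The quadratic form of \<open>P\<close> at \<open>x - t y\<close>: the term
    \<open>x \<bullet> ?y\<close> vanishes by hypothesis, and both cross terms equal
    \<open>a\<close> by symmetry of \<open>P\<close>.\<close>
  have form: "0 \<le> t * (t * c) - 2 * t * a" for t
  proof -
    have "P *\<^sub>v (x - t \<cdot>\<^sub>v ?y) = ?y - t \<cdot>\<^sub>v (P *\<^sub>v ?y)"
      using P x y by (simp add: mult_minus_distrib_mat_vec mult_mat_vec)
    then have "(x - t \<cdot>\<^sub>v ?y) \<bullet> (P *\<^sub>v (x - t \<cdot>\<^sub>v ?y))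
        = x \<bullet> ?y - t * (x \<bullet> (P *\<^sub>v ?y)) - t * (?y \<bullet> ?y) + t * (t * (?y \<bullet> (P *\<^sub>v ?y)))"
      using P x(1) y
      by (simp add: minus_scalar_prod_distrib[where n = n] scalar_prod_minus_distrib[where n = n]
          algebra_simps)
    with nonneg[of "x - t \<cdot>\<^sub>v ?y"] x y show ?thesis
      by (simp add: xPy a_def[symmetric] c_def[symmetric] mult_ac)
  qed
  have "c \<ge> 0" using nonneg[OF y] by (simp add: c_def)
  show "?y \<bullet> ?y = 0"
  proof (rule ccontr)
    assume "?y \<bullet> ?y \<noteq> 0"
    then have a: "a > 0" using scalar_prod_self_nonneg[of ?y] by (simp add: a_def)
    \<comment> \<open>This choice gives \<open>t * c \<le> a\<close>, so the factor
      \<open>t * c - 2 * a\<close> is at most \<open>-a\<close>; adding \<open>a\<close> in the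
      denominator covers the case \<open>c = 0\<close>.\<close>
    define t where "t = a / (a + c)"
    have t: "t > 0" "t * c \<le> a" using a \<open>c \<ge> 0\<close> by (auto simp: t_def field_simps)
    then have "t * (t * c - 2 * a) < 0" using a by (intro mult_pos_neg) auto
    with form[of t] show False by (simp add: algebra_simps)
  qed
  show "?y \<in> carrier_vec n" by (fact y)
qed

text \<open>Symmetry of \<open>D\<close> makes its rows equal to its columns. This turns the trace
  of \<open>D P D\<close> into a sum of values of the quadratic form of \<open>P\<close>.\<close>

lemma congruence_diag:
  fixes P D :: "real mat"
  assumes "P \<in> carrier_mat n n" "D \<in> carrier_mat n n" "D\<^sup>T = D" "i < n"
  shows "(D * (P * D)) $$ (i, i) = col D i \<bullet> (P *\<^sub>v col D i)"
proof -
  have "row D i = col D i" using assms by (metis carrier_matD(2) row_transpose)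
  then show ?thesis using assms by (simp add: col_mult2[of P n n D n i])
qed

text \<open>For \<open>D = P - Q\<close> one has \<open>D P + Q D = 0\<close>, so the traces of \<open>D P D\<close> and \<open>D Q D\<close> add up to
  zero, although all diagonal entries of both are nonnegative; hence \<open>P D = Q D = 0\<close> and
  \<open>D\<^sup>2 = 0\<close>.\<close>

lemma pos_semidef_sqrt_unique:
  assumes P: "pos_semidef_mat P" "P \<in> carrier_mat n n"
    and Q: "pos_semidef_mat Q" "Q \<in> carrier_mat n n"
    and eq: "P * P = Q * Q"
  shows "P = Q"
proof -
  define D where "D = P - Q"
  have D: "D \<in> carrier_mat n n" using P Q by (auto simp: D_def intro: minus_carrier_mat)
  have symPQ: "P\<^sup>T = P" "Q\<^sup>T = Q" using P Q by (simp_all add: pos_semidef_mat_def)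
  have symD: "D\<^sup>T = D"
    using P(2) Q(2) symPQ by (simp add: D_def transpose_minus)
  let ?p = "\<lambda>i. col D i \<bullet> (P *\<^sub>v col D i)" and ?q = "\<lambda>i. col D i \<bullet> (Q *\<^sub>v col D i)"
  have "D * P = P * P - Q * P"
    using P Q by (simp add: D_def minus_mult_distrib_mat)
  moreover have "Q * D = Q * P - Q * Q"
    using P Q by (simp add: D_def mult_minus_distrib_mat)
  ultimately have DP: "D * P = - (Q * D)"
    using P Q eq by (intro eq_matI) auto
  have "(\<Sum>i<n. ?p i) = (\<Sum>i<n. (D * (P * D)) $$ (i, i))"
    using congruence_diag P D symD by simp
  also have "\<dots> = (\<Sum>i<n. (D * P * D) $$ (i, i))"
    using P D by (simp add: assoc_mult_mat[of D n n P n D n])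
  \<comment> \<open>Cyclicity of the trace brings \<open>D * P\<close> together at the right end,
    where \<open>DP\<close> trades it for \<open>-(Q * D)\<close>.\<close>
  also have "\<dots> = (\<Sum>i<n. (D * (D * P)) $$ (i, i))"
    using P D by (intro trace_comm) auto
  also have "\<dots> = (\<Sum>i<n. - (D * (Q * D)) $$ (i, i))"
    using Q D by (intro sum.cong refl) (auto simp: DP)
  also have "\<dots> = - (\<Sum>i<n. ?q i)"
    using congruence_diag Q D symD by (simp add: sum_negf)
  finally have "(\<Sum>i<n. ?p i + ?q i) = 0" by (simp add: sum.distrib)
  moreover have nonneg: "0 \<le> ?p i" "0 \<le> ?q i" if "i < n" for i
    using P Q D that by (auto simp: pos_semidef_mat_def)
  ultimately have pq: "?p i + ?q i = 0" if "i < n" for i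
    using that by (subst (asm) sum_nonneg_eq_0_iff) auto
  have "D *\<^sub>v col D i = 0\<^sub>v n" if i: "i < n" for i
  proof -
    have c: "col D i \<in> carrier_vec n" using D i by simp
    have "?p i = 0" "?q i = 0" using pq[OF i] nonneg[OF i] by linarith+
    then have "P *\<^sub>v col D i = 0\<^sub>v n" "Q *\<^sub>v col D i = 0\<^sub>v n"
      using pos_semidef_mat_kernel P Q c by blast+
    then show ?thesis using P Q c by (simp add: D_def minus_mult_distrib_mat_vec)
  qed
  \<comment> \<open>By symmetry of \<open>D\<close>, this product is entry \<open>i\<close> of
    \<open>D *\<^sub>v col D i\<close>, which has just been shown to vanish.\<close>
  then have "col D i \<bullet> col D i = 0" if "i < n" for i
  proof -
    have "row D i = col D i" using D symD that by (metis carrier_matD(2) row_transpose)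
    then have "col D i \<bullet> col D i = (D *\<^sub>v col D i) $ i" using D that by simp
    with \<open>\<And>i. i < n \<Longrightarrow> D *\<^sub>v col D i = 0\<^sub>v n\<close>[OF that] that show ?thesis by simp
  qed
  then have "col D i = 0\<^sub>v n" if "i < n" for i
    using that D by (intro scalar_prod_self_eq_0) auto
  then have "D $$ (i, j) = 0" if "i < n" "j < n" for i j
    using that D by (metis carrier_matD index_col index_zero_vec(1))
  then show ?thesis
    using P Q by (intro eq_matI) (auto simp: D_def)
qed

lemma sqrt_mat_eqI:
  assumes "pos_semidef_mat P" "P * P = A"
  shows "sqrt_mat A = P"
  unfolding sqrt_mat_def
proof (rule the_equality)
  have carrier: "M \<in> carrier_mat (dim_row M) (dim_row M)" if "pos_semidef_mat M" for M
    using that by (auto simp: pos_semidef_mat_def intro!: carrier_matI)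
  fix Q assume Q: "pos_semidef_mat Q \<and> Q * Q = A"
  \<comment> \<open>The definite description ranges over matrices of every size; the common square
    fixes the size.\<close>
  then have "dim_row Q = dim_row P" using assms(2) by (metis index_mult_mat(2))
  then have "P \<in> carrier_mat (dim_row P) (dim_row P)" "Q \<in> carrier_mat (dim_row P) (dim_row P)"
    using carrier[of P] carrier[of Q] Q assms(1) by metis+
  moreover have "Q * Q = P * P" using Q assms(2) by simp
  ultimately show "Q = P" using Q assms(1) pos_semidef_sqrt_unique by blast
next
  show "pos_semidef_mat P \<and> P * P = A" using assms ..
qed

text \<open>This is \<open>a I + b J\<close> with \<open>J\<close> the all-ones matrix, so diagonal
  entries are \<open>a + b\<close>. Both the Seidel matrix and its absolute value lie in this
  family.\<close>

definition scalar_plus_const_mat :: "nat \<Rightarrow> real \<Rightarrow> real \<Rightarrow> real mat" where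
  "scalar_plus_const_mat n a b = mat n n (\<lambda>(i, j). (if i = j then a else 0) + b)"

text \<open>The family is closed under products because \<open>J * J = n J\<close>, the source of
  the term \<open>real n * b * d\<close>.\<close>

lemma scalar_plus_const_mat_mult:
  "scalar_plus_const_mat n a b * scalar_plus_const_mat n c d
     = scalar_plus_const_mat n (a * c) (a * d + b * c + real n * b * d)"
proof (rule eq_matI)
  fix i j
  assume "i < dim_row (scalar_plus_const_mat n (a * c) (a * d + b * c + real n * b * d))"
    and "j < dim_col (scalar_plus_const_mat n (a * c) (a * d + b * c + real n * b * d))"
  then have ij: "i < n" "j < n" by (simp_all add: scalar_plus_const_mat_def)
  have "(\<Sum>k<n. ((if i = k then a else 0) + b) * ((if k = j then c else 0) + d))
      = (\<Sum>k<n. (if i = k then (if k = j then a * c else 0) + a * d else 0)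
          + (if k = j then b * c else 0) + b * d)"
    by (intro sum.cong refl) (simp add: algebra_simps)
  also have "\<dots> = (if i = j then a * c else 0) + (a * d + b * c + real n * b * d)"
    using ij by (simp add: sum.distrib)
  finally show "(scalar_plus_const_mat n a b * scalar_plus_const_mat n c d) $$ (i, j)
      = scalar_plus_const_mat n (a * c) (a * d + b * c + real n * b * d) $$ (i, j)"
    using ij by (simp add: scalar_plus_const_mat_def scalar_prod_def atLeast0LessThan)
qed (simp_all add: scalar_plus_const_mat_def)

text \<open>The quadratic form at \<open>x\<close> is \<open>a\<close> times the sum of the squared
  entries plus \<open>b\<close> times the square of the sum of the entries.\<close>

lemma pos_semidef_scalar_plus_const_mat:
  assumes "0 \<le> a" "0 \<le> b"
  shows "pos_semidef_mat (scalar_plus_const_mat n a b)"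
  unfolding pos_semidef_mat_def
proof (intro conjI ballI)
  let ?P = "scalar_plus_const_mat n a b"
  show "square_mat ?P" by (simp add: scalar_plus_const_mat_def)
  show "?P\<^sup>T = ?P" by (rule eq_matI) (auto simp: scalar_plus_const_mat_def)
  fix x :: "real vec" assume "x \<in> carrier_vec (dim_row ?P)"
  then have x: "dim_vec x = n" by (simp add: scalar_plus_const_mat_def)
  define s where "s = (\<Sum>k<n. x $ k)"
  have "(?P *\<^sub>v x) $ i = a * x $ i + b * s" if "i < n" for i
  proof -
    have "(?P *\<^sub>v x) $ i = (\<Sum>k<n. (if i = k then a * x $ k else 0) + b * x $ k)"
      using that x
      by (auto simp: scalar_plus_const_mat_def scalar_prod_def atLeast0LessThan distrib_right
          intro!: sum.cong)
    also have "\<dots> = a * x $ i + b * s"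
      using that by (simp add: sum.distrib s_def sum_distrib_left)
    finally show ?thesis .
  qed
  then have "x \<bullet> (?P *\<^sub>v x) = (\<Sum>i<n. x $ i * (a * x $ i + b * s))"
    using x by (simp add: scalar_prod_def atLeast0LessThan scalar_plus_const_mat_def)
  also have "\<dots> = a * (\<Sum>i<n. x $ i * x $ i) + b * (s * s)"
    by (simp add: s_def distrib_left sum.distrib sum_distrib_left sum_distrib_right mult_ac)
  also have "\<dots> \<ge> 0" using assms by (simp add: sum_nonneg)
  finally show "0 \<le> x \<bullet> (?P *\<^sub>v x)" .
qed

text \<open>Injectivity of \<open>v\<close> makes distinct indices adjacent vertices, so every
  off-diagonal entry is \<open>-1\<close>; on the diagonal \<open>1 + (-1) = 0\<close>.\<close>

lemma seidel_mat_complete: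
  assumes "complete_digraph n G" "bij_betw v {..<n} (verts G)"
  shows "seidel_mat G v = scalar_plus_const_mat n 1 (-1)"
proof (rule eq_matI)
  have card: "card (verts G) = n" using bij_betw_same_card[OF assms(2)] by simp
  then show "dim_row (seidel_mat G v) = dim_row (scalar_plus_const_mat n 1 (-1))"
    "dim_col (seidel_mat G v) = dim_col (scalar_plus_const_mat n 1 (-1))"
    by (simp_all add: seidel_mat_def scalar_plus_const_mat_def)
  fix i j
  assume "i < dim_row (scalar_plus_const_mat n 1 (-1))"
    "j < dim_col (scalar_plus_const_mat n 1 (-1))"
  then have ij: "i < n" "j < n" by (simp_all add: scalar_plus_const_mat_def)
  have "(v i, v j) \<in> arcs_ends G" if "i \<noteq> j"
  proof -
    have "v i \<noteq> v j" "v i \<in> verts G" "v j \<in> verts G"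
      using assms(2) ij that by (auto simp: bij_betw_def inj_on_def)
    then show ?thesis using assms(1) by (auto simp: complete_digraph_def)
  qed
  then show "seidel_mat G v $$ (i, j) = scalar_plus_const_mat n 1 (-1) $$ (i, j)"
    using ij card by (auto simp: seidel_mat_def scalar_plus_const_mat_def)
qed

theorem mainTheorem2:
  fixes G :: "('a, 'b) pre_digraph" and v :: "nat \<Rightarrow> 'a" and n :: nat
  assumes "n \<ge> 3"
    and "complete_digraph n G"
    and "bij_betw v {..<n} (verts G)"
  shows "\<forall>i<n. vertex_seidel_energy G v i = 2 * (real n - 1) / real n"
proof -
  let ?S = "scalar_plus_const_mat n 1 (-1)"
  \<comment> \<open>Equating squares asks for \<open>2 b + n b^2 = n - 2\<close>. One root is
    \<open>-1\<close>, which is \<open>?S\<close> itself; the other is \<open>(n - 2) / n\<close>,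
    nonnegative as \<open>n \<ge> 3\<close>.\<close>
  let ?P = "scalar_plus_const_mat n 1 ((real n - 2) / real n)"
  have "pos_semidef_mat ?P"
    using assms(1) by (intro pos_semidef_scalar_plus_const_mat) auto
  moreover have "?P * ?P = ?S * ?S"
    using assms(1) unfolding scalar_plus_const_mat_mult
    by (intro arg_cong2[where f = "scalar_plus_const_mat n"]) (simp_all add: field_simps)
  ultimately have "abs_mat ?S = ?P"
    unfolding abs_mat_def by (rule sqrt_mat_eqI)
  then show ?thesis
    using assms(1)
    by (auto simp: vertex_seidel_energy_def seidel_mat_complete[OF assms(2,3)]
        scalar_plus_const_mat_def field_simps)
qed

end
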